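(* Let $G$ be an eight-dimensional Lie group with Lie algebra $\mathfrak{g}$, equipped with a left-invariant Riemannian metric $g$, and let $K$ be its six-dimensional Lie subgroup $\mathbf{SU}(2)\times\mathbf{SL}_2(\mathbb{R})$ equipped with its standard Riemannian metric, with the orthonormal basis $\{A,B,C,R,S,T\}$ of its Lie algebra $\mathfrak{k}$ described in the context. Then, for a suitable orthonormal basis $\{X,Y\}$ of the orthogonal complement $\mathfrak{m}$ of $\mathfrak{k}$ in $\mathfrak{g}$, the Lie bracket relations for $\mathfrak{g}$ take the following form (the brackets $[U,V]$ with $U\in\{A,B,C\}$, $V\in\{R,S,T\}$ being zero): $$[A,B]=2C,\quad [C,A]=2B,\quad [B,C]=2A,\qquad [R,S]=2T,\quad [T,R]=2S,\quad [S,T]=-2R,$$ $$[A,X]=-b_{11}B-c_{11}C,\quad [A,Y]=-b_{21}B-c_{21}C,$$ $$[B,X]=b_{11}A-c_{12}C,\quad [B,Y]=b_{21}A-c_{22}C,$$ $$[C,X]=c_{11}A+c_{12}B,\quad [C,Y]=c_{21}A+c_{22}B,$$ $$[R,X]=s_{14}S+t_{14}T,\quad [R,Y]=s_{24}S+t_{24}T,$$ $$[S,X]=s_{14}R-t_{15}T,\quad [S,Y]=s_{24}R-t_{25}T,$$ $$[T,X]=t_{14}R+t_{15}S,\quad [T,Y]=t_{24}R+t_{25}S,$$ $$[X,Y]=\rho X+\theta_1A+\theta_2B+\theta_3C+\theta_4R+\theta_5S+\theta_6T.$$ Here the 13 different real coefficients $b_{11},b_{21},c_{11},c_{12},c_{21},c_{22},s_{14},s_{24},t_{14},t_{15},t_{24},t_{25},\rho$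 are arbitrary and $\theta_1,\dots,\theta_6$ are given by $$\theta_1=\tfrac12(-\rho c_{12}+b_{11}c_{21}-b_{21}c_{11}),\quad \theta_2=\tfrac12(\rho c_{11}+b_{11}c_{22}-b_{21}c_{12}),\quad \theta_3=\tfrac12(-\rho b_{11}+c_{11}c_{22}-c_{12}c_{21}),$$ $$\theta_4=\tfrac12(-\rho t_{15}-s_{14}t_{24}+s_{24}t_{14}),\quad \theta_5=\tfrac12(-\rho t_{14}-s_{14}t_{25}+s_{24}t_{15}),\quad \theta_6=\tfrac12(\rho s_{14}-t_{14}t_{25}+t_{15}t_{24}).$$
   Context: The metric $g$ on $G$ is left-invariant and restricts to the standard metric on $K=\mathbf{SU}(2)\times\mathbf{SL}_2(\mathbb{R})$: $\mathfrak{k}=\mathfrak{su}(2)\times\mathfrak{sl}_2(\mathbb{R})$ has a basis $\{A,B,C,R,S,T\}$, orthonormal with respect to $g$, such that $\{A,B,C\}$ spans $\mathfrak{su}(2)$, $\{R,S,T\}$ spans $\mathfrak{sl}_2(\mathbb{R})$, and $[A,B]=2C$, $[C,A]=2B$, $[B,C]=2A$, $[R,S]=2T$, $[T,R]=2S$, $[S,T]=-2R$, with the two factors commuting. Then $\{A,B,C,R,S,T,X,Y\}$ is an orthonormal basis of $\mathfrak{g}$.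
   Formalization: Adds that the foliation of G by cosets of K is conformal (false otherwise, e.g. SU(2)×(SL2(R)⋉R²); the stated relations imply it). Everything is stated for the metric Lie algebra; "arbitrary" means each choice of the 13 coefficients gives a Lie bracket on g. *)

theory Defs
  imports "HOL-Analysis.Analysis"
begin

text \<open>
  A Lie group with a left-invariant Riemannian metric is represented by its Lie algebra: the metric
  is the inner product of an ambient Euclidean space, and the Lie bracket is a binary operation on
  that space. A connected subgroup is represented by the subspace that is its Lie algebra.
\<close>

definition lie_bracket :: "('a::real_vector \<Rightarrow> 'a \<Rightarrow> 'a) \<Rightarrow> bool" where
  "lie_bracket br \<longleftrightarrow> bilinear br \<and> (\<forall>x. br x x = 0) \<and>
     (\<forall>x y z. br x (br y z) + br y (br z x) + br z (br x y) = 0)"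

definition orthonormal_basis :: "'a::euclidean_space list \<Rightarrow> 'a set \<Rightarrow> bool" where
  "orthonormal_basis vs W \<longleftrightarrow>
     distinct vs \<and> pairwise orthogonal (set vs) \<and> (\<forall>v\<in>set vs. norm v = 1) \<and> span (set vs) = W"

text \<open>
  The Levi-Civita connection on left-invariant vector fields. The inner products
  of three left-invariant fields are constant, so the Koszul formula reduces to
  \<open>2 \<langle>\<nabla>\<^sub>U V, W\<rangle> = \<langle>[U,V], W\<rangle> + \<langle>[W,U], V\<rangle> + \<langle>U, [W,V]\<rangle>\<close>.
\<close>

definition levi_civita :: "('a::euclidean_space \<Rightarrow> 'a \<Rightarrow> 'a) \<Rightarrow> 'a \<Rightarrow> 'a \<Rightarrow> 'a" where
  "levi_civita br U V =
     (\<Sum>W\<in>Basis. ((1/2) * (br U V \<bullet> W + br W U \<bullet> V + U \<bullet> br W V)) *\<^sub>R W)"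

text \<open>
  The foliation whose leaves are the cosets of the subgroup of \<open>k\<close> has vertical space \<open>k\<close> and
  horizontal space \<open>k\<^sup>\<bottom>\<close>. It is conformal if the second fundamental form of the horizontal
  distribution, \<open>B(E,F) = 1/2 (\<nabla>\<^sub>E F + \<nabla>\<^sub>F E)\<^sup>v\<close> with \<open>v\<close> the vertical part, equals \<open>g(E,F) V\<close> for
  some vertical \<open>V\<close>. The vertical part is tested here by inner products with elements of \<open>k\<close>.
\<close>

definition conformal_foliation :: "('a::euclidean_space \<Rightarrow> 'a \<Rightarrow> 'a) \<Rightarrow> 'a set \<Rightarrow> bool" where
  "conformal_foliation br k \<longleftrightarrow>
     (\<exists>V\<in>k. \<forall>E\<in>k\<^sup>\<bottom>. \<forall>F\<in>k\<^sup>\<bottom>. \<forall>U\<in>k.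
        ((1/2) *\<^sub>R (levi_civita br E F + levi_civita br F E)) \<bullet> U = ((E \<bullet> F) *\<^sub>R V) \<bullet> U)"

definition su2_sl2_relations ::
    "('a::real_vector \<Rightarrow> 'a \<Rightarrow> 'a) \<Rightarrow> 'a \<Rightarrow> 'a \<Rightarrow> 'a \<Rightarrow> 'a \<Rightarrow> 'a \<Rightarrow> 'a \<Rightarrow> bool" where
  "su2_sl2_relations br A B C R S T \<longleftrightarrow>
     br A B = 2 *\<^sub>R C \<and> br C A = 2 *\<^sub>R B \<and> br B C = 2 *\<^sub>R A \<and>
     br R S = 2 *\<^sub>R T \<and> br T R = 2 *\<^sub>R S \<and> br S T = - 2 *\<^sub>R R \<and>
     (\<forall>U\<in>{A, B, C}. \<forall>V\<in>{R, S, T}. br U V = 0)"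

definition bracket_relations ::
    "('a::real_vector \<Rightarrow> 'a \<Rightarrow> 'a) \<Rightarrow> 'a \<Rightarrow> 'a \<Rightarrow> 'a \<Rightarrow> 'a \<Rightarrow> 'a \<Rightarrow> 'a \<Rightarrow> 'a \<Rightarrow> 'a \<Rightarrow>
     real \<Rightarrow> real \<Rightarrow> real \<Rightarrow> real \<Rightarrow> real \<Rightarrow> real \<Rightarrow>
     real \<Rightarrow> real \<Rightarrow> real \<Rightarrow> real \<Rightarrow> real \<Rightarrow> real \<Rightarrow> real \<Rightarrow> bool" where
  "bracket_relations br A B C R S T X Y
       b11 b21 c11 c12 c21 c22 s14 s24 t14 t15 t24 t25 \<rho> \<longleftrightarrow>
     su2_sl2_relations br A B C R S T \<and>
     br A X = - b11 *\<^sub>R B - c11 *\<^sub>R C \<and> br A Y = - b21 *\<^sub>R B - c21 *\<^sub>R C \<and>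
     br B X = b11 *\<^sub>R A - c12 *\<^sub>R C \<and> br B Y = b21 *\<^sub>R A - c22 *\<^sub>R C \<and>
     br C X = c11 *\<^sub>R A + c12 *\<^sub>R B \<and> br C Y = c21 *\<^sub>R A + c22 *\<^sub>R B \<and>
     br R X = s14 *\<^sub>R S + t14 *\<^sub>R T \<and> br R Y = s24 *\<^sub>R S + t24 *\<^sub>R T \<and>
     br S X = s14 *\<^sub>R R - t15 *\<^sub>R T \<and> br S Y = s24 *\<^sub>R R - t25 *\<^sub>R T \<and>
     br T X = t14 *\<^sub>R R + t15 *\<^sub>R S \<and> br T Y = t24 *\<^sub>R R + t25 *\<^sub>R S \<and>
     (let \<theta>1 = (1/2) * (- \<rho> * c12 + b11 * c21 - b21 * c11);
          \<theta>2 = (1/2) * (\<rho> * c11 + b11 * c22 - b21 * c12);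
          \<theta>3 = (1/2) * (- \<rho> * b11 + c11 * c22 - c12 * c21);
          \<theta>4 = (1/2) * (- \<rho> * t15 - s14 * t24 + s24 * t14);
          \<theta>5 = (1/2) * (- \<rho> * t14 - s14 * t25 + s24 * t15);
          \<theta>6 = (1/2) * (\<rho> * s14 - t14 * t25 + t15 * t24)
      in br X Y = \<rho> *\<^sub>R X + \<theta>1 *\<^sub>R A + \<theta>2 *\<^sub>R B + \<theta>3 *\<^sub>R C + \<theta>4 *\<^sub>R R + \<theta>5 *\<^sub>R S + \<theta>6 *\<^sub>R T)"

end

theory Submission
  imports Defs
begin

text \<open>
  Conformality makes \<open>k\<close> act on \<open>g/k\<close> by the commuting matrices \<open>a I + b J\<close>. As \<open>k\<close> is
  perfect, this action is trivial, so \<open>ad X\<close> and \<open>ad Y\<close> restrict to derivations of \<open>k\<close>, and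
  their coefficients are determined by the derivation rule on the brackets of the basis. A
  rotation of \<open>X, Y\<close> removes the \<open>Y\<close>-component of \<open>[X, Y]\<close>, and the Jacobi identity for
  \<open>X\<close>, \<open>Y\<close> and an element of \<open>k\<close> gives the \<open>\<theta>\<^sub>i\<close>, since \<open>k\<close> has trivial center.

  Conversely, the derivations of \<open>k\<close> are inner, so the relations prescribe \<open>u, v \<in> k\<close> for which
  \<open>X - u\<close> and \<open>Y - v\<close> centralize \<open>k\<close>. The required algebra is then the direct product
  of \<open>k\<close> and a two-dimensional Lie algebra.
\<close>

section \<open>Conformality in terms of the Lie bracket\<close>

text \<open>The Koszul expression is linear in \<open>W\<close>, so the coordinates prescribed on
  \<open>Basis\<close> determine it for every \<open>W\<close>.\<close>

lemma levi_civita_inner: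
  assumes "bilinear br"
  shows "levi_civita br U V \<bullet> W = (1/2) * (br U V \<bullet> W + br W U \<bullet> V + U \<bullet> br W V)"
proof -
  define f where "f W = (1/2) * (br U V \<bullet> W + br W U \<bullet> V + U \<bullet> br W V)" for W
  interpret linear f
    by (rule linearI)
      (simp_all add: f_def bilinear_ladd[OF assms] bilinear_lmul[OF assms] inner_add inner_distrib
        algebra_simps)
  have "levi_civita br U V \<bullet> W = (\<Sum>b\<in>Basis. (W \<bullet> b) * f b)"
    by (simp add: levi_civita_def f_def inner_sum_left inner_commute[of W] mult.commute)
  also have "\<dots> = f (\<Sum>b\<in>Basis. (W \<bullet> b) *\<^sub>R b)"
    by (simp add: sum scale)
  finally show ?thesis
    by (simp add: euclidean_representation f_def)
qed

lemma lie_bracket_commute: "br y x = - br x y" if "lie_bracket br"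
proof -
  have br: "bilinear br" and alt: "\<And>z. br z z = 0"
    using that by (auto simp: lie_bracket_def)
  have "br (x + y) (x + y) = br x y + br y x"
    unfolding bilinear_ladd[OF br] bilinear_radd[OF br] by (simp add: alt)
  then have "br x y + br y x = 0"
    unfolding alt by simp
  then show ?thesis
    by (simp add: eq_neg_iff_add_eq_0 add.commute)
qed

text \<open>Symmetrizing the Koszul formula cancels \<open>br E F\<close> against
  \<open>br F E\<close>. What is left is twice the symmetric part of \<open>br U\<close> compressed
  to \<open>k\<^sup>\<bottom>\<close>, and conformality makes it a scalar multiple of the identity
  that depends linearly on \<open>U\<close>.\<close>

lemma conformal_foliation_iff:
  assumes "lie_bracket br"
  shows "conformal_foliation br k \<longleftrightarrow>
    (\<exists>V\<in>k. \<forall>E\<in>k\<^sup>\<bottom>. \<forall>F\<in>k\<^sup>\<bottom>. \<forall>U\<in>k. br U E \<bullet> F + br U F \<bullet> E = 2 * (E \<bullet> F) * (V \<bullet> U))"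
proof -
  have br: "bilinear br"
    using assms by (simp add: lie_bracket_def)
  have "(levi_civita br E F + levi_civita br F E) \<bullet> U
      = br U E \<bullet> F + br U F \<bullet> E" for E F U
    by (simp add: levi_civita_inner[OF br] inner_add_left lie_bracket_commute[OF assms, of F E]
        inner_commute[of E] inner_commute[of F] field_simps)
  then show ?thesis
    unfolding conformal_foliation_def by (simp only: inner_scaleR_left) (simp add: field_simps)
qed

section \<open>Orthonormal bases and orthogonal complements\<close>

lemma inner_orthonormal_basis:
  assumes "orthonormal_basis vs W" "u \<in> set vs" "v \<in> set vs"
  shows "u \<bullet> v = (if u = v then 1 else 0)"
  using assms unfolding orthonormal_basis_def pairwise_def orthogonal_def
  by (auto simp: norm_eq_1)

lemma orthonormal_basis_memI:
  assumes "orthonormal_basis vs W" "v \<in> set vs"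
  shows "v \<in> W"
  using assms span_base unfolding orthonormal_basis_def by blast

lemma orthonormal_basis_coordinates:
  assumes "orthonormal_basis vs W" "x \<in> W"
  shows "(\<Sum>v\<leftarrow>vs. (x \<bullet> v) *\<^sub>R v) = x"
  using assms orthonormal_basis_expand[of "set vs" x]
  by (simp add: orthonormal_basis_def sum_list_distinct_conv_sum_set)

lemma orthonormal_basis_exists:
  fixes W :: "'a::euclidean_space set"
  assumes "subspace W"
  obtains vs where "orthonormal_basis vs W" "length vs = dim W"
proof -
  obtain B where B: "pairwise orthogonal B" "\<And>x. x \<in> B \<Longrightarrow> norm x = 1"
    "independent B" "card B = dim W" "span B = W"
    using orthonormal_basis_subspace[OF assms] by metis
  then obtain vs where "set vs = B" "distinct vs"
    using finite_distinct_list independent_imp_finite by metis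
  with B that show ?thesis
    by (auto simp: orthonormal_basis_def distinct_card[symmetric])
qed

lemma dim_orthonormal_basis:
  fixes W :: "'a::euclidean_space set"
  assumes "orthonormal_basis vs W"
  shows "dim W = length vs"
proof -
  have "independent (set vs)"
    using assms by (intro pairwise_orthogonal_independent) (auto simp: orthonormal_basis_def)
  then have "dim (span (set vs)) = card (set vs)"
    by (metis dim_span dim_eq_card_independent)
  then show ?thesis
    using assms by (metis distinct_card orthonormal_basis_def)
qed

lemma dim_orthogonal_comp:
  fixes W :: "'a::euclidean_space set"
  assumes "subspace W"
  shows "dim (W\<^sup>\<bottom>) + dim W = DIM('a)"
  using dim_subspace_orthogonal_to_vectors[OF assms subspace_UNIV]
  by (simp add: orthogonal_comp_def)

text \<open>A rotation preserves the inner products, and the inverse rotation recovers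
  \<open>X\<close> and \<open>Y\<close>, so the span does not change.\<close>

lemma orthonormal_basis_rotate:
  assumes XY: "orthonormal_basis [X, Y] W" and cs: "c\<^sup>2 + s\<^sup>2 = (1::real)"
  defines "X' \<equiv> c *\<^sub>R X + s *\<^sub>R Y" and "Y' \<equiv> c *\<^sub>R Y - s *\<^sub>R X"
  shows "orthonormal_basis [X', Y'] W"
proof -
  have [simp]: "X \<bullet> X = 1" "Y \<bullet> Y = 1" "X \<bullet> Y = 0" "Y \<bullet> X = 0"
    using XY by (auto simp: inner_orthonormal_basis[OF XY] orthonormal_basis_def)
  have inner: "X' \<bullet> X' = 1" "Y' \<bullet> Y' = 1" "X' \<bullet> Y' = 0" "Y' \<bullet> X' = 0"
    using cs by (simp_all add: X'_def Y'_def inner_simps power2_eq_square algebra_simps)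
  have "c *\<^sub>R X' - s *\<^sub>R Y' = (c\<^sup>2 + s\<^sup>2) *\<^sub>R X"
    "s *\<^sub>R X' + c *\<^sub>R Y' = (c\<^sup>2 + s\<^sup>2) *\<^sub>R Y"
    by (simp_all add: X'_def Y'_def algebra_simps power2_eq_square)
  then have inverse: "X = c *\<^sub>R X' - s *\<^sub>R Y'" "Y = s *\<^sub>R X' + c *\<^sub>R Y'"
    by (simp_all add: cs)
  have "c *\<^sub>R X + s *\<^sub>R Y \<in> span {X, Y}" "c *\<^sub>R Y - s *\<^sub>R X \<in> span {X, Y}"
    "c *\<^sub>R X' - s *\<^sub>R Y' \<in> span {X', Y'}" "s *\<^sub>R X' + c *\<^sub>R Y' \<in> span {X', Y'}"
    by (simp_all add: span_add span_diff span_scale span_base)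
  then have "{X', Y'} \<subseteq> span {X, Y}" "{X, Y} \<subseteq> span {X', Y'}"
    unfolding inverse[symmetric] X'_def[symmetric] Y'_def[symmetric] by blast+
  then have "span {X', Y'} = span {X, Y}"
    by (simp add: span_eq)
  then have "span (set [X', Y']) = W"
    using XY by (simp add: orthonormal_basis_def)
  moreover have "X' \<noteq> Y'"
    using inner by (metis zero_neq_one)
  moreover have "pairwise orthogonal (set [X', Y'])"
    using inner by (simp add: pairwise_insert orthogonal_def)
  moreover have "\<forall>v\<in>set [X', Y']. norm v = 1"
    using inner by (simp add: norm_eq_1)
  ultimately show ?thesis
    by (simp add: orthonormal_basis_def)
qed

section \<open>Coordinates in a frame adapted to \<open>k\<close> and its complement\<close>

locale orthonormal_frame =
  fixes k :: "'a::euclidean_space set" and A B C R S T X Y :: 'a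
  assumes basis_k: "orthonormal_basis [A, B, C, R, S, T] k"
    and basis_m: "orthonormal_basis [X, Y] (k\<^sup>\<bottom>)"
begin

lemma subspace_k: "subspace k"
  using basis_k by (auto simp: orthonormal_basis_def)

lemma mem_k [simp]: "A \<in> k" "B \<in> k" "C \<in> k" "R \<in> k" "S \<in> k" "T \<in> k"
  by (simp_all add: orthonormal_basis_memI[OF basis_k])

lemma mem_m [simp]: "X \<in> k\<^sup>\<bottom>" "Y \<in> k\<^sup>\<bottom>"
  by (simp_all add: orthonormal_basis_memI[OF basis_m])

lemma inner_k_m:
  assumes "U \<in> k" "E \<in> k\<^sup>\<bottom>"
  shows "U \<bullet> E = 0" "E \<bullet> U = 0"
  using assms by (auto simp: orthogonal_comp_def orthogonal_def inner_commute)

lemma distinct_frame: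
  "A \<noteq> B" "A \<noteq> C" "A \<noteq> R" "A \<noteq> S" "A \<noteq> T" "B \<noteq> C" "B \<noteq> R" "B \<noteq> S" "B \<noteq> T"
  "C \<noteq> R" "C \<noteq> S" "C \<noteq> T" "R \<noteq> S" "R \<noteq> T" "S \<noteq> T" "X \<noteq> Y"
  using basis_k basis_m by (simp_all add: orthonormal_basis_def)

lemma inner_frame [simp]:
  "A \<bullet> A = 1" "A \<bullet> B = 0" "A \<bullet> C = 0" "A \<bullet> R = 0" "A \<bullet> S = 0" "A \<bullet> T = 0"
  "B \<bullet> A = 0" "B \<bullet> B = 1" "B \<bullet> C = 0" "B \<bullet> R = 0" "B \<bullet> S = 0" "B \<bullet> T = 0"
  "C \<bullet> A = 0" "C \<bullet> B = 0" "C \<bullet> C = 1" "C \<bullet> R = 0" "C \<bullet> S = 0" "C \<bullet> T = 0"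
  "R \<bullet> A = 0" "R \<bullet> B = 0" "R \<bullet> C = 0" "R \<bullet> R = 1" "R \<bullet> S = 0" "R \<bullet> T = 0"
  "S \<bullet> A = 0" "S \<bullet> B = 0" "S \<bullet> C = 0" "S \<bullet> R = 0" "S \<bullet> S = 1" "S \<bullet> T = 0"
  "T \<bullet> A = 0" "T \<bullet> B = 0" "T \<bullet> C = 0" "T \<bullet> R = 0" "T \<bullet> S = 0" "T \<bullet> T = 1"
  "X \<bullet> X = 1" "X \<bullet> Y = 0" "Y \<bullet> X = 0" "Y \<bullet> Y = 1"
  "A \<bullet> X = 0" "B \<bullet> X = 0" "C \<bullet> X = 0" "R \<bullet> X = 0" "S \<bullet> X = 0" "T \<bullet> X = 0"
  "A \<bullet> Y = 0" "B \<bullet> Y = 0" "C \<bullet> Y = 0" "R \<bullet> Y = 0" "S \<bullet> Y = 0" "T \<bullet> Y = 0"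
  "X \<bullet> A = 0" "X \<bullet> B = 0" "X \<bullet> C = 0" "X \<bullet> R = 0" "X \<bullet> S = 0" "X \<bullet> T = 0"
  "Y \<bullet> A = 0" "Y \<bullet> B = 0" "Y \<bullet> C = 0" "Y \<bullet> R = 0" "Y \<bullet> S = 0" "Y \<bullet> T = 0"
  by (simp_all add: inner_orthonormal_basis[OF basis_k] inner_orthonormal_basis[OF basis_m]
      inner_k_m distinct_frame distinct_frame[symmetric])

lemma k_coordinates:
  assumes "x \<in> k"
  shows "(x \<bullet> A) *\<^sub>R A + (x \<bullet> B) *\<^sub>R B + (x \<bullet> C) *\<^sub>R C
    + (x \<bullet> R) *\<^sub>R R + (x \<bullet> S) *\<^sub>R S + (x \<bullet> T) *\<^sub>R T = x"
  using orthonormal_basis_coordinates[OF basis_k assms] by (simp add: add.assoc)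

text \<open>The whole space is the sum of \<open>k\<close> and \<open>k\<^sup>\<bottom>\<close>, so
  the expansions in the two bases combine.\<close>

lemma frame_coordinates:
  "(x \<bullet> A) *\<^sub>R A + (x \<bullet> B) *\<^sub>R B + (x \<bullet> C) *\<^sub>R C
    + (x \<bullet> R) *\<^sub>R R + (x \<bullet> S) *\<^sub>R S + (x \<bullet> T) *\<^sub>R T + (x \<bullet> X) *\<^sub>R X + (x \<bullet> Y) *\<^sub>R Y = x"
proof -
  obtain y z where yz: "x = y + z" "y \<in> k" "z \<in> k\<^sup>\<bottom>"
    using subspace_sum_orthogonal_comp[OF subspace_k] set_plus_elim by blast
  have k: "x \<bullet> U = y \<bullet> U" if "U \<in> k" for U
    using that yz by (simp add: inner_add_left inner_k_m)
  have m: "x \<bullet> E = z \<bullet> E" if "E \<in> k\<^sup>\<bottom>" for E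
    using that yz by (simp add: inner_add_left inner_k_m)
  have "(z \<bullet> X) *\<^sub>R X + (z \<bullet> Y) *\<^sub>R Y = z"
    using orthonormal_basis_coordinates[OF basis_m yz(3)] by simp
  then show ?thesis
    unfolding k[OF mem_k(1)] k[OF mem_k(2)] k[OF mem_k(3)]
      k[OF mem_k(4)] k[OF mem_k(5)] k[OF mem_k(6)] m[OF mem_m(1)] m[OF mem_m(2)]
      k_coordinates[OF yz(2)] by (simp add: yz(1) add.assoc)
qed

lemma frame_eqI:
  assumes "x \<bullet> A = y \<bullet> A" "x \<bullet> B = y \<bullet> B" "x \<bullet> C = y \<bullet> C" "x \<bullet> R = y \<bullet> R" "x \<bullet> S = y \<bullet> S"
    "x \<bullet> T = y \<bullet> T" "x \<bullet> X = y \<bullet> X" "x \<bullet> Y = y \<bullet> Y"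
  shows "x = y"
  using frame_coordinates[of x] unfolding assms frame_coordinates by simp

lemma mem_k_iff: "x \<in> k \<longleftrightarrow> x \<bullet> X = 0 \<and> x \<bullet> Y = 0"
proof
  assume "x \<bullet> X = 0 \<and> x \<bullet> Y = 0"
  then have "(x \<bullet> A) *\<^sub>R A + (x \<bullet> B) *\<^sub>R B + (x \<bullet> C) *\<^sub>R C
    + (x \<bullet> R) *\<^sub>R R + (x \<bullet> S) *\<^sub>R S + (x \<bullet> T) *\<^sub>R T = x"
    using frame_coordinates[of x] by simp
  then show "x \<in> k"
    by (metis mem_k subspace_add subspace_k subspace_scale)
qed (simp add: inner_k_m)

section \<open>Model algebras realizing all coefficients\<close>

text \<open>On the span of \<open>A\<close>, \<open>B\<close>, \<open>C\<close> this is twice the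
  cross product; on the span of \<open>R\<close>, \<open>S\<close>, \<open>T\<close> it is twice the
  Lorentzian cross product, with the sign of the \<open>R\<close> component reversed. Components
  along \<open>X\<close> and \<open>Y\<close> are ignored, which makes the operation total and
  bilinear on the whole space.\<close>

definition k_bracket :: "'a \<Rightarrow> 'a \<Rightarrow> 'a" where
  "k_bracket x y =
     (2 * ((x \<bullet> B) * (y \<bullet> C) - (x \<bullet> C) * (y \<bullet> B))) *\<^sub>R A +
     (2 * ((x \<bullet> C) * (y \<bullet> A) - (x \<bullet> A) * (y \<bullet> C))) *\<^sub>R B +
     (2 * ((x \<bullet> A) * (y \<bullet> B) - (x \<bullet> B) * (y \<bullet> A))) *\<^sub>R C +
     (- 2 * ((x \<bullet> S) * (y \<bullet> T) - (x \<bullet> T) * (y \<bullet> S))) *\<^sub>R R +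
     (2 * ((x \<bullet> T) * (y \<bullet> R) - (x \<bullet> R) * (y \<bullet> T))) *\<^sub>R S +
     (2 * ((x \<bullet> R) * (y \<bullet> S) - (x \<bullet> S) * (y \<bullet> R))) *\<^sub>R T"

lemma inner_k_bracket [simp]:
  "k_bracket x y \<bullet> A = 2 * ((x \<bullet> B) * (y \<bullet> C) - (x \<bullet> C) * (y \<bullet> B))"
  "k_bracket x y \<bullet> B = 2 * ((x \<bullet> C) * (y \<bullet> A) - (x \<bullet> A) * (y \<bullet> C))"
  "k_bracket x y \<bullet> C = 2 * ((x \<bullet> A) * (y \<bullet> B) - (x \<bullet> B) * (y \<bullet> A))"
  "k_bracket x y \<bullet> R = - 2 * ((x \<bullet> S) * (y \<bullet> T) - (x \<bullet> T) * (y \<bullet> S))"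
  "k_bracket x y \<bullet> S = 2 * ((x \<bullet> T) * (y \<bullet> R) - (x \<bullet> R) * (y \<bullet> T))"
  "k_bracket x y \<bullet> T = 2 * ((x \<bullet> R) * (y \<bullet> S) - (x \<bullet> S) * (y \<bullet> R))"
  "k_bracket x y \<bullet> X = 0" "k_bracket x y \<bullet> Y = 0"
  by (simp_all add: k_bracket_def inner_add_left)

lemma bilinear_k_bracket: "bilinear k_bracket"
  unfolding bilinear_def
  by (auto intro!: linearI; rule frame_eqI; simp add: inner_add_left algebra_simps)

lemma k_bracket_jacobi:
  "k_bracket x (k_bracket y z) + k_bracket y (k_bracket z x) + k_bracket z (k_bracket x y) = 0"
  by (rule frame_eqI) (simp_all add: inner_add_left algebra_simps)

text \<open>The model of the Lie algebra is the direct product of \<open>k\<close> with the ideal spanned by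
  \<open>X - u\<close> and \<open>Y - v\<close>, where \<open>[X - u, Y - v] = \<rho> (X - u)\<close>; the map \<open>k_part u v\<close> is the
  projection onto the first factor along the second.\<close>

definition k_part :: "'a \<Rightarrow> 'a \<Rightarrow> 'a \<Rightarrow> 'a" where
  "k_part u v x = x + (x \<bullet> X) *\<^sub>R (u - X) + (x \<bullet> Y) *\<^sub>R (v - Y)"

definition product_bracket :: "'a \<Rightarrow> 'a \<Rightarrow> real \<Rightarrow> 'a \<Rightarrow> 'a \<Rightarrow> 'a" where
  "product_bracket u v \<rho> x y = k_bracket (k_part u v x) (k_part u v y)
     + (\<rho> * ((x \<bullet> X) * (y \<bullet> Y) - (x \<bullet> Y) * (y \<bullet> X))) *\<^sub>R (X - u)"

text \<open>The projection \<open>P\<close> fixes \<open>k\<close> and kills \<open>X - u\<close>,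
  hence carries the bracket to \<open>k_bracket\<close>. The Jacobi identity then splits into the
  one for \<open>k_bracket\<close> and a scalar identity for the coefficients of
  \<open>X - u\<close>. Since \<open>k\<close> is an ideal, conformality holds with
  \<open>V = 0\<close>.\<close>

lemma product_bracket:
  assumes uv: "u \<in> k" "v \<in> k"
  shows lie_bracket_product_bracket: "lie_bracket (product_bracket u v \<rho>)"
    and conformal_product_bracket: "conformal_foliation (product_bracket u v \<rho>) k"
proof -
  define P where "P = k_part u v"
  have P_eq: "P x = x + (x \<bullet> X) *\<^sub>R (u - X) + (x \<bullet> Y) *\<^sub>R (v - Y)" for x
    by (simp add: P_def k_part_def)
  define br where "br = product_bracket u v \<rho>"
  have br_eq: "br x y = k_bracket (P x) (P y)
     + (\<rho> * ((x \<bullet> X) * (y \<bullet> Y) - (x \<bullet> Y) * (y \<bullet> X))) *\<^sub>R (X - u)" for x y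
    by (simp add: br_def product_bracket_def P_def)
  have [simp]: "u \<bullet> X = 0" "u \<bullet> Y = 0" "v \<bullet> X = 0" "v \<bullet> Y = 0"
    using uv by (simp_all add: mem_k_iff)
  interpret P: linear P
    by (rule linearI) (simp_all add: P_eq inner_add_left algebra_simps)
  have [simp]: "P x = x" if "x \<in> k" for x
    using that by (simp add: P_eq mem_k_iff)
  have "P (X - u) = 0"
    by (simp add: P_eq inner_diff_left)
  moreover have "k_bracket x y \<in> k" for x y
    by (simp add: mem_k_iff)
  ultimately have P_br: "P (br x y) = k_bracket (P x) (P y)" for x y
    by (simp add: br_eq P.add P.scale)
  have br_X: "br x y \<bullet> X = \<rho> * ((x \<bullet> X) * (y \<bullet> Y) - (x \<bullet> Y) * (y \<bullet> X))" for x y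
    by (simp add: br_eq inner_add_left inner_diff_left)
  have br_Y: "br x y \<bullet> Y = 0" for x y
    by (simp add: br_eq inner_add_left inner_diff_left)
  have jacobi: "br x (br y z) + br y (br z x) + br z (br x y) = 0" for x y z
  proof -
    have expand: "br x (br y z) = k_bracket (P x) (k_bracket (P y) (P z))
        - (\<rho> * (x \<bullet> Y) * (\<rho> * ((y \<bullet> X) * (z \<bullet> Y) - (y \<bullet> Y) * (z \<bullet> X)))) *\<^sub>R (X - u)" for x y z
      unfolding br_eq[of x] P_br br_X br_Y by (simp add: mult.assoc)
    \<comment> \<open>The coefficients of \<open>X - u\<close> add up to a multiple of a 3 by 3
      determinant with two equal rows, formed by the \<open>Y\<close> components, so they
      cancel.\<close>
    have "br x (br y z) + br y (br z x) + br z (br x y)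
      = k_bracket (P x) (k_bracket (P y) (P z)) + k_bracket (P y) (k_bracket (P z) (P x))
        + k_bracket (P z) (k_bracket (P x) (P y))"
      unfolding expand by (simp add: algebra_simps)
    then show ?thesis
      by (simp add: k_bracket_jacobi)
  qed
  have "bilinear br"
    unfolding bilinear_def br_eq
    by (auto intro!: linearI simp: P.add P.scale bilinear_ladd[OF bilinear_k_bracket]
        bilinear_radd[OF bilinear_k_bracket] bilinear_lmul[OF bilinear_k_bracket]
        bilinear_rmul[OF bilinear_k_bracket] inner_add_left algebra_simps)
  moreover have "br x x = 0" for x
    by (simp add: br_eq k_bracket_def)
  ultimately have lie: "lie_bracket br"
    by (simp add: lie_bracket_def jacobi)
  then show "lie_bracket (product_bracket u v \<rho>)"
    by (simp add: br_def)
  have "br U E \<bullet> F = 0" if "U \<in> k" "F \<in> k\<^sup>\<bottom>" for U E F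
  proof -
    have "br U E \<in> k"
      using that(1) by (simp add: mem_k_iff br_X br_Y)
    then show ?thesis
      using that(2) by (rule inner_k_m)
  qed
  then show "conformal_foliation (product_bracket u v \<rho>) k"
    unfolding br_def[symmetric] conformal_foliation_iff[OF lie]
    using subspace_0[OF subspace_k] by (intro bexI[of _ 0]) simp_all
qed

text \<open>In the product model \<open>[X, Y] = [u, v] + \<rho> (X - u)\<close>. The prescribed
  \<theta> coefficients are therefore the coordinates of
  \<open>k_bracket u v - \<rho> u\<close>.\<close>

lemma bracket_relations_exist:
  "\<exists>br. lie_bracket br \<and> conformal_foliation br k \<and>
     bracket_relations br A B C R S T X Y
       b11 b21 c11 c12 c21 c22 s14 s24 t14 t15 t24 t25 \<rho>"
proof -
  \<comment> \<open>\<open>u\<close> and \<open>v\<close> solve \<open>[W, u] = [W, X]\<close> and \<open>[W, v] = [W, Y]\<close> for all \<open>W \<in> k\<close>.\<close>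
  define u where "u = (c12/2) *\<^sub>R A + (- c11/2) *\<^sub>R B + (b11/2) *\<^sub>R C
    + (t15/2) *\<^sub>R R + (t14/2) *\<^sub>R S + (- s14/2) *\<^sub>R T"
  define v where "v = (c22/2) *\<^sub>R A + (- c21/2) *\<^sub>R B + (b21/2) *\<^sub>R C
    + (t25/2) *\<^sub>R R + (t24/2) *\<^sub>R S + (- s24/2) *\<^sub>R T"
  have [simp]:
    "u \<bullet> A = c12/2" "u \<bullet> B = - c11/2" "u \<bullet> C = b11/2" "u \<bullet> R = t15/2" "u \<bullet> S = t14/2"
    "u \<bullet> T = - s14/2" "u \<bullet> X = 0" "u \<bullet> Y = 0"
    "v \<bullet> A = c22/2" "v \<bullet> B = - c21/2" "v \<bullet> C = b21/2" "v \<bullet> R = t25/2" "v \<bullet> S = t24/2"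
    "v \<bullet> T = - s24/2" "v \<bullet> X = 0" "v \<bullet> Y = 0"
    by (simp_all add: u_def v_def inner_add_left inner_diff_left)
  have [simp]: "k_part u v U = U" if "U \<in> {A, B, C, R, S, T}" for U
    using that by (auto simp: k_part_def)
  have [simp]: "k_part u v X = u" "k_part u v Y = v"
    by (simp_all add: k_part_def)
  have "u \<in> k" "v \<in> k"
    by (simp_all add: mem_k_iff)
  note product_bracket[OF this, of \<rho>]
  moreover have "bracket_relations (product_bracket u v \<rho>) A B C R S T X Y
       b11 b21 c11 c12 c21 c22 s14 s24 t14 t15 t24 t25 \<rho>"
    unfolding bracket_relations_def su2_sl2_relations_def Let_def
    by (intro conjI ballI; (elim insertE emptyE)?; hypsubst?; rule frame_eqI)
      (simp_all add: product_bracket_def inner_add_left inner_diff_left field_simps)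
  ultimately show ?thesis
    by blast
qed

end

section \<open>Structure of a conformal extension of \<open>k\<close>\<close>

locale conformal_extension = orthonormal_frame k A B C R S T X Y
  for k :: "'a::euclidean_space set" and A B C R S T X Y +
  fixes br :: "'a \<Rightarrow> 'a \<Rightarrow> 'a"
  assumes lie: "lie_bracket br"
    and rel: "su2_sl2_relations br A B C R S T"
    and conformal: "conformal_foliation br k"
begin

lemma bilinear_br: "bilinear br"
  using lie by (simp add: lie_bracket_def)

lemmas br_linear =
  bilinear_ladd[OF bilinear_br] bilinear_radd[OF bilinear_br]
  bilinear_lsub[OF bilinear_br] bilinear_rsub[OF bilinear_br]
  bilinear_lmul[OF bilinear_br] bilinear_rmul[OF bilinear_br]
  bilinear_lneg[OF bilinear_br] bilinear_rneg[OF bilinear_br]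

lemmas br_commute = lie_bracket_commute[OF lie]

lemma br_br_left: "br (br U W) E = br U (br W E) - br W (br U E)"
proof -
  have "br U (br W E) + br W (br E U) + br E (br U W) = 0"
    using lie by (simp add: lie_bracket_def)
  then show ?thesis
    using br_commute[of E U] br_commute[of E "br U W"] by (simp add: br_linear)
qed

lemma br_frame:
  "br A B = 2 *\<^sub>R C" "br C A = 2 *\<^sub>R B" "br B C = 2 *\<^sub>R A"
  "br R S = 2 *\<^sub>R T" "br T R = 2 *\<^sub>R S" "br S T = - 2 *\<^sub>R R"
  using rel by (simp_all add: su2_sl2_relations_def)

text \<open>The relations fix the bracket on pairs of basis vectors and bilinearity does the rest.
  Computations inside \<open>k\<close> thereby reduce to explicit coordinates.\<close>

lemma br_k_eq:
  assumes "U \<in> k" "W \<in> k"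
  shows "br U W = k_bracket U W"
proof -
  have alt: "br U U = 0" for U
    using lie by (simp add: lie_bracket_def)
  have comm: "br A R = 0" "br A S = 0" "br A T = 0" "br B R = 0" "br B S = 0" "br B T = 0"
    "br C R = 0" "br C S = 0" "br C T = 0"
    using rel by (simp_all add: su2_sl2_relations_def)
  have eq: "br U W = k_bracket U W"
    if "U \<in> {A, B, C, R, S, T}" "W \<in> {A, B, C, R, S, T}" for U W
    using that
    by (elim insertE emptyE; hypsubst)
      (simp_all add: k_bracket_def alt comm br_frame br_commute[of B A] br_commute[of A C]
        br_commute[of C B] br_commute[of S R] br_commute[of R T] br_commute[of T S]
        br_commute[of R A] br_commute[of S A] br_commute[of T A] br_commute[of R B]
        br_commute[of S B] br_commute[of T B] br_commute[of R C] br_commute[of S C]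
        br_commute[of T C])
  have "k \<subseteq> span {A, B, C, R, S, T}"
    using basis_k by (simp add: orthonormal_basis_def)
  then show ?thesis
    using bilinear_eq[OF bilinear_br bilinear_k_bracket _ _ assms] eq by blast
qed

lemma br_k_mem: "U \<in> k \<Longrightarrow> W \<in> k \<Longrightarrow> br U W \<in> k"
  by (simp add: br_k_eq mem_k_iff)

text \<open>As \<open>br U\<close> preserves \<open>k\<close>, it induces a map on the quotient by
  \<open>k\<close>, where \<open>z\<close> is represented by its \<open>X\<close> and
  \<open>Y\<close> components. This gives the matrix of that map.\<close>

lemma inner_br_br:
  assumes "U \<in> k" and F: "F \<in> k\<^sup>\<bottom>"
  shows "br U z \<bullet> F = (z \<bullet> X) * (br U X \<bullet> F) + (z \<bullet> Y) * (br U Y \<bullet> F)"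
proof -
  have "z - (z \<bullet> X) *\<^sub>R X - (z \<bullet> Y) *\<^sub>R Y \<in> k"
    by (simp add: mem_k_iff inner_diff_left)
  then have "br U (z - (z \<bullet> X) *\<^sub>R X - (z \<bullet> Y) *\<^sub>R Y) \<bullet> F = 0"
    using assms by (intro inner_k_m(1) br_k_mem)
  then show ?thesis
    by (simp add: br_linear inner_diff_left)
qed

text \<open>Conformality says that \<open>k\<close> acts on its complement by similarities, that is, by matrices
  \<open>a I + b J\<close>. These commute, so the commutators, which span \<open>k\<close>, act trivially.\<close>

lemma br_commutator_mem_k:
  assumes "U \<in> k" "W \<in> k" "E \<in> {X, Y}"
  shows "br (br U W) E \<in> k"
proof -
  obtain V where V: "\<And>E F U. E \<in> k\<^sup>\<bottom> \<Longrightarrow> F \<in> k\<^sup>\<bottom> \<Longrightarrow> U \<in> k \<Longrightarrow>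
      br U E \<bullet> F + br U F \<bullet> E = 2 * (E \<bullet> F) * (V \<bullet> U)"
    using conformal unfolding conformal_foliation_iff[OF lie] by blast
  \<comment> \<open>The pairs \<open>X, X\<close> and \<open>Y, Y\<close> both give
    \<open>V \<bullet> U\<close>, so the diagonal entries agree; the pair \<open>X, Y\<close> makes
    the other two entries opposite.\<close>
  have sim: "br U Y \<bullet> Y = br U X \<bullet> X" "br U Y \<bullet> X = - (br U X \<bullet> Y)" if "U \<in> k" for U
    using V[of X X U] V[of Y Y U] V[of X Y U] that by simp_all
  show ?thesis
    using assms(3) unfolding mem_k_iff br_br_left
    by (auto simp: inner_diff_left inner_br_br[OF assms(1), where z = "br W Z" for Z]
        inner_br_br[OF assms(2), where z = "br U Z" for Z] sim[OF assms(1)] sim[OF assms(2)])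
qed

text \<open>Perfectness of \<open>k\<close>: every basis vector is a multiple of a bracket of two
  others, so the result for commutators applies to it.\<close>

lemma br_m_mem_k:
  assumes "U \<in> {A, B, C, R, S, T}" "E \<in> {X, Y}"
  shows "br U E \<in> k"
proof -
  have "A = (1/2) *\<^sub>R br B C" "B = (1/2) *\<^sub>R br C A" "C = (1/2) *\<^sub>R br A B"
    "R = (-1/2) *\<^sub>R br S T" "S = (1/2) *\<^sub>R br T R" "T = (1/2) *\<^sub>R br R S"
    by (simp_all add: br_frame)
  then have "\<exists>c. \<exists>V\<in>k. \<exists>W\<in>k. U = c *\<^sub>R br V W"
    using assms(1) mem_k by (elim insertE emptyE) metis+
  then show ?thesis
    using br_commutator_mem_k[OF _ _ assms(2)]
    by (auto simp: bilinear_lmul[OF bilinear_br] subspace_scale[OF subspace_k])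
qed

text \<open>Bracketing with \<open>E\<close> is a derivation of \<open>k\<close>. Comparing
  coordinates in the derivation rule for the six basic brackets shows that it preserves both
  factors, is skew on the span of \<open>A\<close>, \<open>B\<close>, \<open>C\<close>, and is skew
  on the span of \<open>R\<close>, \<open>S\<close>, \<open>T\<close> for the Lorentzian form in
  which \<open>R\<close> is the negative direction.\<close>

lemma br_m_form:
  assumes "E \<in> {X, Y}"
  shows "br A E = (br A E \<bullet> B) *\<^sub>R B + (br A E \<bullet> C) *\<^sub>R C"
    and "br B E = - (br A E \<bullet> B) *\<^sub>R A + (br B E \<bullet> C) *\<^sub>R C"
    and "br C E = - (br A E \<bullet> C) *\<^sub>R A - (br B E \<bullet> C) *\<^sub>R B"
    and "br R E = (br R E \<bullet> S) *\<^sub>R S + (br R E \<bullet> T) *\<^sub>R T"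
    and "br S E = (br R E \<bullet> S) *\<^sub>R R + (br S E \<bullet> T) *\<^sub>R T"
    and "br T E = (br R E \<bullet> T) *\<^sub>R R - (br S E \<bullet> T) *\<^sub>R S"
proof -
  have mem: "br A E \<in> k" "br B E \<in> k" "br C E \<in> k" "br R E \<in> k" "br S E \<in> k" "br T E \<in> k"
    using br_m_mem_k assms by simp_all
  then have [simp]: "br A E \<bullet> X = 0" "br B E \<bullet> X = 0" "br C E \<bullet> X = 0" "br R E \<bullet> X = 0"
    "br S E \<bullet> X = 0" "br T E \<bullet> X = 0" "br A E \<bullet> Y = 0" "br B E \<bullet> Y = 0" "br C E \<bullet> Y = 0"
    "br R E \<bullet> Y = 0" "br S E \<bullet> Y = 0" "br T E \<bullet> Y = 0"
    by (simp_all add: mem_k_iff)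
  have derivation: "br (br U W) E = k_bracket U (br W E) - k_bracket W (br U E)"
    if "U \<in> {A, B, C, R, S, T}" "W \<in> {A, B, C, R, S, T}" for U W
  proof -
    have "U \<in> k" "W \<in> k"
      using that mem_k by blast+
    then show ?thesis
      unfolding br_br_left by (simp only: br_k_eq br_m_mem_k[OF that(1) assms] br_m_mem_k[OF that(2) assms])
  qed
  have d:
    "2 *\<^sub>R br C E = k_bracket A (br B E) - k_bracket B (br A E)"
    "2 *\<^sub>R br B E = k_bracket C (br A E) - k_bracket A (br C E)"
    "2 *\<^sub>R br A E = k_bracket B (br C E) - k_bracket C (br B E)"
    "2 *\<^sub>R br T E = k_bracket R (br S E) - k_bracket S (br R E)"
    "2 *\<^sub>R br S E = k_bracket T (br R E) - k_bracket R (br T E)"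
    "(- 2) *\<^sub>R br R E = k_bracket S (br T E) - k_bracket T (br S E)"
    by (simp_all only: bilinear_lmul[OF bilinear_br, symmetric] br_frame[symmetric] derivation
        insert_iff simp_thms)
  note coordinates = d[THEN arg_cong[where f = "\<lambda>x. x \<bullet> U" for U],
      unfolded inner_diff_left inner_scaleR_left inner_k_bracket]
  note abc = coordinates[of A, simplified] coordinates[of B, simplified] coordinates[of C, simplified]
    and rst = coordinates[of R, simplified] coordinates[of S, simplified] coordinates[of T, simplified]
  \<comment> \<open>Within each block of three, every diagonal entry equals the sum of the other
    two, so all of them vanish.\<close>
  have diag: "br A E \<bullet> A = 0" "br B E \<bullet> B = 0" "br C E \<bullet> C = 0"
    "br R E \<bullet> R = 0" "br S E \<bullet> S = 0" "br T E \<bullet> T = 0"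
    using abc rst by linarith+
  have skew: "br B E \<bullet> A = - (br A E \<bullet> B)" "br C E \<bullet> A = - (br A E \<bullet> C)"
    "br C E \<bullet> B = - (br B E \<bullet> C)" "br S E \<bullet> R = br R E \<bullet> S" "br T E \<bullet> R = br R E \<bullet> T"
    "br T E \<bullet> S = - (br S E \<bullet> T)"
    using abc rst by linarith+
  \<comment> \<open>Each basis vector is a multiple of a bracket within its own factor, and
    \<open>k_bracket\<close> with an argument in one factor takes values in that factor.\<close>
  have mixed:
    "br A E \<bullet> R = 0" "br A E \<bullet> S = 0" "br A E \<bullet> T = 0"
    "br B E \<bullet> R = 0" "br B E \<bullet> S = 0" "br B E \<bullet> T = 0"
    "br C E \<bullet> R = 0" "br C E \<bullet> S = 0" "br C E \<bullet> T = 0"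
    "br R E \<bullet> A = 0" "br R E \<bullet> B = 0" "br R E \<bullet> C = 0"
    "br S E \<bullet> A = 0" "br S E \<bullet> B = 0" "br S E \<bullet> C = 0"
    "br T E \<bullet> A = 0" "br T E \<bullet> B = 0" "br T E \<bullet> C = 0"
    by (rule abc rst)+
  show "br A E = (br A E \<bullet> B) *\<^sub>R B + (br A E \<bullet> C) *\<^sub>R C"
    "br B E = - (br A E \<bullet> B) *\<^sub>R A + (br B E \<bullet> C) *\<^sub>R C"
    "br C E = - (br A E \<bullet> C) *\<^sub>R A - (br B E \<bullet> C) *\<^sub>R B"
    "br R E = (br R E \<bullet> S) *\<^sub>R S + (br R E \<bullet> T) *\<^sub>R T"
    "br S E = (br R E \<bullet> S) *\<^sub>R R + (br S E \<bullet> T) *\<^sub>R T"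
    "br T E = (br R E \<bullet> T) *\<^sub>R R - (br S E \<bullet> T) *\<^sub>R S"
    by (rule frame_eqI; simp add: inner_add_left inner_diff_left diag skew mixed)+
qed

text \<open>The assumption leaves \<open>br X Y = \<rho> X + z\<close> with \<open>z\<close> in
  \<open>k\<close>. The Jacobi identity for \<open>U\<close>, \<open>X\<close>, \<open>Y\<close>
  then determines \<open>k_bracket U z\<close> for all \<open>U\<close> in \<open>k\<close>, and
  this determines \<open>z\<close> because \<open>k\<close> has trivial center.\<close>

lemma bracket_relations:
  assumes "br X Y \<bullet> Y = 0"
  shows "\<exists>b11 b21 c11 c12 c21 c22 s14 s24 t14 t15 t24 t25 \<rho>.
    bracket_relations br A B C R S T X Y b11 b21 c11 c12 c21 c22 s14 s24 t14 t15 t24 t25 \<rho>"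
proof -
  define b11 b21 c11 c12 c21 c22 s14 s24 t14 t15 t24 t25 \<rho> where
    "b11 = - (br A X \<bullet> B)" and "b21 = - (br A Y \<bullet> B)" and
    "c11 = - (br A X \<bullet> C)" and "c12 = - (br B X \<bullet> C)" and
    "c21 = - (br A Y \<bullet> C)" and "c22 = - (br B Y \<bullet> C)" and
    "s14 = br R X \<bullet> S" and "s24 = br R Y \<bullet> S" and
    "t14 = br R X \<bullet> T" and "t15 = - (br S X \<bullet> T)" and
    "t24 = br R Y \<bullet> T" and "t25 = - (br S Y \<bullet> T)" and "\<rho> = br X Y \<bullet> X"
  note coefficients = this
  have "(br A X \<bullet> B) = - b11" "(br A Y \<bullet> B) = - b21" "(br A X \<bullet> C) = - c11" "(br B X \<bullet> C) = - c12"
    "(br A Y \<bullet> C) = - c21" "(br B Y \<bullet> C) = - c22" "(br S X \<bullet> T) = - t15" "(br S Y \<bullet> T) = - t25"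
    by (simp_all add: coefficients)
  note br_X = br_m_form[of X, simplified, unfolded this coefficients(7,9)[symmetric]]
    and br_Y = br_m_form[of Y, simplified, unfolded this coefficients(8,11)[symmetric]]
  define z where "z = br X Y - \<rho> *\<^sub>R X"
  have "z \<in> k"
    using assms by (simp add: mem_k_iff z_def inner_diff_left coefficients)
  have z: "\<rho> *\<^sub>R br U X + k_bracket U z = br (br U X) Y - br (br U Y) X" if "U \<in> k" for U
  proof -
    have "br U (br X Y) = br (br U X) Y - br (br U Y) X"
      using br_br_left[of U X Y] br_commute[of X "br U Y"] by (simp add: algebra_simps)
    moreover have "br U (br X Y) = \<rho> *\<^sub>R br U X + br U z"
      by (simp add: z_def br_linear)
    ultimately show ?thesis
      using \<open>z \<in> k\<close> that by (simp add: br_k_eq)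
  qed
  note z' = z[THEN arg_cong[where f = "\<lambda>x. x \<bullet> U" for U], unfolded inner_diff_left inner_add_left]
  \<comment> \<open>The \<open>C\<close> coordinate of the identity for \<open>U = B\<close>
    isolates one unknown, since \<open>k_bracket B z \<bullet> C = - 2 * (z \<bullet> A)\<close>.
    The other five pairs are chosen in the same way.\<close>
  have theta1: "z \<bullet> A = (1/2) * (- \<rho> * c12 + b11 * c21 - b21 * c11)"
    using z'[of B C] by (simp add: br_X br_Y br_linear algebra_simps)
  have theta2: "z \<bullet> B = (1/2) * (\<rho> * c11 + b11 * c22 - b21 * c12)"
    using z'[of A C] by (simp add: br_X br_Y br_linear algebra_simps)
  have theta3: "z \<bullet> C = (1/2) * (- \<rho> * b11 + c11 * c22 - c12 * c21)"
    using z'[of A B] by (simp add: br_X br_Y br_linear algebra_simps)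
  have theta4: "z \<bullet> R = (1/2) * (- \<rho> * t15 - s14 * t24 + s24 * t14)"
    using z'[of S T] by (simp add: br_X br_Y br_linear algebra_simps)
  have theta5: "z \<bullet> S = (1/2) * (- \<rho> * t14 - s14 * t25 + s24 * t15)"
    using z'[of R T] by (simp add: br_X br_Y br_linear algebra_simps)
  have theta6: "z \<bullet> T = (1/2) * (\<rho> * s14 - t14 * t25 + t15 * t24)"
    using z'[of R S] by (simp add: br_X br_Y br_linear algebra_simps)
  have "br X Y = \<rho> *\<^sub>R X + (z \<bullet> A) *\<^sub>R A + (z \<bullet> B) *\<^sub>R B + (z \<bullet> C) *\<^sub>R C
      + (z \<bullet> R) *\<^sub>R R + (z \<bullet> S) *\<^sub>R S + (z \<bullet> T) *\<^sub>R T"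
    using k_coordinates[OF \<open>z \<in> k\<close>] by (simp add: z_def add.assoc)
  then have "bracket_relations br A B C R S T X Y
      b11 b21 c11 c12 c21 c22 s14 s24 t14 t15 t24 t25 \<rho>"
    unfolding bracket_relations_def Let_def theta1 theta2 theta3 theta4 theta5 theta6
    using rel by (simp add: br_X br_Y)
  then show ?thesis
    by blast
qed

end

section \<open>Choice of \<open>X\<close>, \<open>Y\<close> and conclusion\<close>

text \<open>A rotation has determinant 1, so it leaves the bracket of the two basis vectors
  unchanged. It remains to turn the first vector into the direction of the projection of that
  bracket to \<open>W\<close>; if the projection is zero, the given basis already works.\<close>

lemma orthonormal_basis_br_aligned:
  assumes "lie_bracket br" "orthonormal_basis [X\<^sub>0, Y\<^sub>0] W"
  obtains X Y where "orthonormal_basis [X, Y] W" "br X Y \<bullet> Y = 0"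
proof (cases "br X\<^sub>0 Y\<^sub>0 \<bullet> X\<^sub>0 = 0 \<and> br X\<^sub>0 Y\<^sub>0 \<bullet> Y\<^sub>0 = 0")
  case True
  then show ?thesis
    using that assms by blast
next
  case False
  \<comment> \<open>The projection of \<open>br X\<^sub>0 Y\<^sub>0\<close> to \<open>W\<close> is
    \<open>p X\<^sub>0 + q Y\<^sub>0\<close>, of length \<open>r\<close>. With
    \<open>c = p / r\<close> and \<open>s = q / r\<close> it becomes \<open>r X\<close>, which is
    orthogonal to \<open>Y\<close>.\<close>
  define p q where "p = br X\<^sub>0 Y\<^sub>0 \<bullet> X\<^sub>0" and "q = br X\<^sub>0 Y\<^sub>0 \<bullet> Y\<^sub>0"
  define r where "r = sqrt (p\<^sup>2 + q\<^sup>2)"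
  have "p\<^sup>2 + q\<^sup>2 > 0"
    using False by (simp add: p_def q_def sum_power2_gt_zero_iff)
  then have r: "r \<noteq> 0" "r\<^sup>2 = p\<^sup>2 + q\<^sup>2"
    unfolding r_def by (metis real_sqrt_gt_zero less_irrefl, simp)
  define c s where "c = p / r" and "s = q / r"
  have cs: "c\<^sup>2 + s\<^sup>2 = 1"
    using r(1) by (simp add: c_def s_def power_divide add_divide_distrib[symmetric] r(2)[symmetric])
  define X Y where "X = c *\<^sub>R X\<^sub>0 + s *\<^sub>R Y\<^sub>0" and "Y = c *\<^sub>R Y\<^sub>0 - s *\<^sub>R X\<^sub>0"
  have br: "bilinear br" and alt: "\<And>x. br x x = 0"
    using assms(1) by (auto simp: lie_bracket_def)
  have "br X Y = (c\<^sup>2 + s\<^sup>2) *\<^sub>R br X\<^sub>0 Y\<^sub>0"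
    by (simp add: X_def Y_def bilinear_ladd[OF br] bilinear_rsub[OF br] bilinear_lmul[OF br]
        bilinear_rmul[OF br] alt lie_bracket_commute[OF assms(1), of Y\<^sub>0 X\<^sub>0]
        power2_eq_square algebra_simps)
  then have "br X Y \<bullet> Y = c * q - s * p"
    by (simp add: cs Y_def p_def q_def inner_diff_right)
  then have "br X Y \<bullet> Y = 0"
    by (simp add: c_def s_def)
  moreover have "orthonormal_basis [X, Y] W"
    unfolding X_def Y_def by (rule orthonormal_basis_rotate[OF assms(2) cs])
  ultimately show ?thesis
    using that by blast
qed

text \<open>The second conjunct expresses that the thirteen coefficients are arbitrary: no choice of
  them is excluded by the Jacobi identity or by conformality.\<close>

theorem proposition5p1:
  fixes k :: "'a::euclidean_space set"
    and A B C R S T :: 'a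
  assumes dim_g: "DIM('a) = 8"
    and basis_k: "orthonormal_basis [A, B, C, R, S, T] k"
  shows "(\<forall>br. lie_bracket br \<and> su2_sl2_relations br A B C R S T \<and> conformal_foliation br k \<longrightarrow>
            (\<exists>X Y. orthonormal_basis [X, Y] (k\<^sup>\<bottom>) \<and>
               (\<exists>b11 b21 c11 c12 c21 c22 s14 s24 t14 t15 t24 t25 \<rho>.
                  bracket_relations br A B C R S T X Y
                    b11 b21 c11 c12 c21 c22 s14 s24 t14 t15 t24 t25 \<rho>))) \<and>
         (\<forall>X Y b11 b21 c11 c12 c21 c22 s14 s24 t14 t15 t24 t25 \<rho>.
            orthonormal_basis [X, Y] (k\<^sup>\<bottom>) \<longrightarrow>
            (\<exists>br. lie_bracket br \<and> conformal_foliation br k \<and>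
               bracket_relations br A B C R S T X Y
                 b11 b21 c11 c12 c21 c22 s14 s24 t14 t15 t24 t25 \<rho>))"
proof (intro conjI allI impI)
  fix br
  assume br: "lie_bracket br \<and> su2_sl2_relations br A B C R S T \<and> conformal_foliation br k"
  have "subspace k"
    using basis_k by (auto simp: orthonormal_basis_def)
  then have "dim (k\<^sup>\<bottom>) = 2"
    using dim_orthogonal_comp[of k] dim_orthonormal_basis[OF basis_k] dim_g by simp
  moreover obtain vs where vs: "orthonormal_basis vs (k\<^sup>\<bottom>)" "length vs = dim (k\<^sup>\<bottom>)"
    using orthonormal_basis_exists[OF subspace_orthogonal_comp] .
  ultimately obtain X\<^sub>0 Y\<^sub>0 where "vs = [X\<^sub>0, Y\<^sub>0]"
    by (auto simp: numeral_2_eq_2 length_Suc_conv)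
  then obtain X Y where XY: "orthonormal_basis [X, Y] (k\<^sup>\<bottom>)" "br X Y \<bullet> Y = 0"
    using orthonormal_basis_br_aligned vs(1) br by metis
  interpret conformal_extension k A B C R S T X Y br
    by unfold_locales (use basis_k XY br in auto)
  show "\<exists>X Y. orthonormal_basis [X, Y] (k\<^sup>\<bottom>) \<and>
    (\<exists>b11 b21 c11 c12 c21 c22 s14 s24 t14 t15 t24 t25 \<rho>.
       bracket_relations br A B C R S T X Y
         b11 b21 c11 c12 c21 c22 s14 s24 t14 t15 t24 t25 \<rho>)"
    using XY(1) bracket_relations[OF XY(2)] by blast
next
  fix X Y and b11 b21 c11 c12 c21 c22 s14 s24 t14 t15 t24 t25 \<rho> :: real
  assume "orthonormal_basis [X, Y] (k\<^sup>\<bottom>)"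
  then interpret orthonormal_frame k A B C R S T X Y
    by unfold_locales (use basis_k in auto)
  show "\<exists>br. lie_bracket br \<and> conformal_foliation br k \<and>
    bracket_relations br A B C R S T X Y
      b11 b21 c11 c12 c21 c22 s14 s24 t14 t15 t24 t25 \<rho>"
    by (rule bracket_relations_exist)
qed

end
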